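(* Let $G_1$ and $G_2$ be graphs with $|V(G_1)|=n$ and $|V(G_2)|=m$, where $m>n+1$ and $\Delta(G_1)\ge\Delta(G_2)$. If $G_1$ satisfies the TCC, i.e. $\chi''(G_1)\le\Delta(G_1)+2$, then the join $G=G_1\vee G_2$ satisfies the AVD-TCC, i.e. $\chi''_a(G)\le\Delta(G)+3$.
   Context: All graphs are finite, undirected and simple. $\Delta(G)$ is the maximum degree of $G$. A proper total coloring of $G$ is a coloring of $V(G)\cup E(G)$ in which no two adjacent or incident elements receive the same color. The total chromatic number $\chi''(G)$ is the least number of colors in a proper total coloring of $G$. An adjacent vertex distinguishing (AVD) total coloring of $G$ is a proper total coloring $f$ such that $C_G(u)\ne C_G(v)$ for every edge $uv\in E(G)$, where $C_G(u)=\{f(u)\}\cup\{f(uw): uw\in E(G)\}$. The AVD-total chromatic number $\chi''_a(G)$ is the least number of colors in an AVD-total coloring of $G$. The join $G_1\vee G_2$ is obtained from the disjoint union of $G_1$ and $G_2$ by adding all edges between a vertex of $G_1$ and a vertex of $G_2$. *)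

theory Defs
  imports Main
begin

record 'a ugraph =
  verts :: "'a set"
  edges :: "'a set set"

definition finite_simple_graph :: "'a ugraph \<Rightarrow> bool" where
  "finite_simple_graph G \<longleftrightarrow>
     finite (verts G) \<and> (\<forall>e\<in>edges G. e \<subseteq> verts G \<and> card e = 2)"

definition vertex_degree :: "'a ugraph \<Rightarrow> 'a \<Rightarrow> nat" where
  "vertex_degree G v = card {e \<in> edges G. v \<in> e}"

text \<open>Inserting 0 only matters for the graph without vertices, whose maximum degree is 0.\<close>

definition max_degree :: "'a ugraph \<Rightarrow> nat" where
  "max_degree G = Max (insert 0 (vertex_degree G ` verts G))"

text \<open>The sum type makes the vertex sets disjoint, so the two graphs may have arbitrary,
  possibly equal, vertex types.\<close>

definition graph_join :: "'a ugraph \<Rightarrow> 'b ugraph \<Rightarrow> ('a + 'b) ugraph" where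
  "graph_join G H =
     \<lparr> verts = Inl ` verts G \<union> Inr ` verts H,
       edges = (\<lambda>e. Inl ` e) ` edges G \<union> (\<lambda>e. Inr ` e) ` edges H
             \<union> {{Inl u, Inr v} | u v. u \<in> verts G \<and> v \<in> verts H} \<rparr>"

datatype 'a element = Vertex 'a | Edge "'a set"

definition elements :: "'a ugraph \<Rightarrow> 'a element set" where
  "elements G = Vertex ` verts G \<union> Edge ` edges G"

fun adjacent_or_incident :: "'a ugraph \<Rightarrow> 'a element \<Rightarrow> 'a element \<Rightarrow> bool" where
  "adjacent_or_incident G (Vertex u) (Vertex v) \<longleftrightarrow> {u, v} \<in> edges G"
| "adjacent_or_incident G (Edge e) (Edge e') \<longleftrightarrow> e \<noteq> e' \<and> e \<inter> e' \<noteq> {}"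
| "adjacent_or_incident G (Vertex u) (Edge e) \<longleftrightarrow> u \<in> e"
| "adjacent_or_incident G (Edge e) (Vertex u) \<longleftrightarrow> u \<in> e"

definition proper_total_coloring :: "'a ugraph \<Rightarrow> ('a element \<Rightarrow> 'c) \<Rightarrow> bool" where
  "proper_total_coloring G f \<longleftrightarrow>
     (\<forall>x\<in>elements G. \<forall>y\<in>elements G. adjacent_or_incident G x y \<longrightarrow> f x \<noteq> f y)"

definition color_set :: "'a ugraph \<Rightarrow> ('a element \<Rightarrow> 'c) \<Rightarrow> 'a \<Rightarrow> 'c set" where
  "color_set G f u = {f (Vertex u)} \<union> {f (Edge {u, w}) | w. {u, w} \<in> edges G}"

definition avd_total_coloring :: "'a ugraph \<Rightarrow> ('a element \<Rightarrow> 'c) \<Rightarrow> bool" where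
  "avd_total_coloring G f \<longleftrightarrow> proper_total_coloring G f \<and>
     (\<forall>u v. {u, v} \<in> edges G \<longrightarrow> color_set G f u \<noteq> color_set G f v)"

definition total_chromatic_number :: "'a ugraph \<Rightarrow> nat" where
  "total_chromatic_number G =
     (LEAST k. \<exists>f :: 'a element \<Rightarrow> nat.
        f ` elements G \<subseteq> {..<k} \<and> proper_total_coloring G f)"

definition avd_total_chromatic_number :: "'a ugraph \<Rightarrow> nat" where
  "avd_total_chromatic_number G =
     (LEAST k. \<exists>f :: 'a element \<Rightarrow> nat.
        f ` elements G \<subseteq> {..<k} \<and> avd_total_coloring G f)"

text \<open>The join is again a finite simple graph, and on finite simple graphs both minima
  range over a nonempty set of numbers of colors and hence are attained.\<close>

lemma finite_simple_graph_join:
  assumes "finite_simple_graph G" "finite_simple_graph H"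
  shows "finite_simple_graph (graph_join G H)"
proof -
  have "e \<subseteq> verts (graph_join G H) \<and> card e = 2" if "e \<in> edges (graph_join G H)" for e
  proof -
    from that consider e' where "e = Inl ` e'" "e' \<in> edges G"
      | e' where "e = Inr ` e'" "e' \<in> edges H"
      | u v where "e = {Inl u, Inr v}" "u \<in> verts G" "v \<in> verts H"
      unfolding graph_join_def by auto
    then show ?thesis
    proof cases
      case 1
      then have "e' \<subseteq> verts G" "card e' = 2"
        using assms by (simp_all add: finite_simple_graph_def)
      with 1 show ?thesis
        by (auto simp: graph_join_def card_image)
    next
      case 2
      then have "e' \<subseteq> verts H" "card e' = 2"
        using assms by (simp_all add: finite_simple_graph_def)
      with 2 show ?thesis
        by (auto simp: graph_join_def card_image)
    next
      case 3
      then show ?thesis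
        by (simp add: graph_join_def)
    qed
  qed
  moreover have "finite (verts (graph_join G H))"
    using assms by (simp add: finite_simple_graph_def graph_join_def)
  ultimately show ?thesis
    by (simp add: finite_simple_graph_def)
qed

lemma finite_elements:
  assumes "finite_simple_graph G"
  shows "finite (elements G)"
proof -
  have "edges G \<subseteq> Pow (verts G)" "finite (verts G)"
    using assms by (auto simp: finite_simple_graph_def)
  then have "finite (edges G)"
    by (meson finite_Pow_iff finite_subset)
  then show ?thesis
    using \<open>finite (verts G)\<close> by (simp add: elements_def)
qed

lemma ex_avd_total_coloring:
  assumes G: "finite_simple_graph G"
  shows "\<exists>k. \<exists>f :: 'a element \<Rightarrow> nat. f ` elements G \<subseteq> {..<k} \<and> avd_total_coloring G f"
proof -
  obtain f :: "'a element \<Rightarrow> nat" and k where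
    f: "f ` elements G = {i. i < k}" and inj: "inj_on f (elements G)"
    using finite_imp_inj_to_nat_seg[OF finite_elements[OF G]] by metis
  have loop: "{u} \<notin> edges G" for u
    using G by (auto simp: finite_simple_graph_def)
  have elem: "x \<in> verts G" if "{x, y} \<in> edges G" for x y
    using G that by (auto simp: finite_simple_graph_def)
  have "f x \<noteq> f y"
    if "x \<in> elements G" "y \<in> elements G" "adjacent_or_incident G x y" for x y
  proof -
    have "x \<noteq> y"
      using that(3) loop by (cases x; cases y) auto
    then show ?thesis
      using inj that(1,2) by (auto dest: inj_onD)
  qed
  moreover have "color_set G f u \<noteq> color_set G f v" if uv: "{u, v} \<in> edges G" for u v
  proof
    assume "color_set G f u = color_set G f v"
    then have "f (Vertex u) \<in> color_set G f v"
      by (auto simp: color_set_def)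
    then consider "f (Vertex u) = f (Vertex v)"
      | w where "f (Vertex u) = f (Edge {v, w})" "{v, w} \<in> edges G"
      by (auto simp: color_set_def)
    then show False
    proof cases
      case 1
      have "u \<in> verts G" "v \<in> verts G"
        using elem[of u v] elem[of v u] uv by (auto simp: insert_commute)
      then have "u = v"
        using inj_onD[OF inj 1] by (auto simp: elements_def)
      then show False
        using uv loop by simp
    next
      case 2
      then show False
        using inj_onD[OF inj 2(1)] elem[OF uv] by (auto simp: elements_def)
    qed
  qed
  ultimately have "avd_total_coloring G f"
    by (auto simp: avd_total_coloring_def proper_total_coloring_def)
  then show ?thesis
    using f by (intro exI[of _ k] exI[of _ f]) auto
qed

lemma total_chromatic_number_attained:
  assumes "finite_simple_graph G"
  shows "\<exists>f :: 'a element \<Rightarrow> nat.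
    f ` elements G \<subseteq> {..<total_chromatic_number G} \<and> proper_total_coloring G f"
  unfolding total_chromatic_number_def
  by (rule LeastI_ex) (metis (no_types, lifting) ex_avd_total_coloring[OF assms] avd_total_coloring_def)

lemma avd_total_chromatic_number_attained:
  assumes "finite_simple_graph G"
  shows "\<exists>f :: 'a element \<Rightarrow> nat.
    f ` elements G \<subseteq> {..<avd_total_chromatic_number G} \<and> avd_total_coloring G f"
  unfolding avd_total_chromatic_number_def
  by (rule LeastI_ex) (rule ex_avd_total_coloring[OF assms])

end

theory Submission
  imports Defs "HOL-Combinatorics.Transposition"
begin

text \<open>Color \<open>G\<^sub>1\<close> totally and the edges of \<open>G\<^sub>2\<close> (by Vizing's theorem) with the same
  \<open>D = \<Delta>(G\<^sub>1) + 2\<close> colors, and use \<open>m + 1\<close> further colors, indexed by residues modulo \<open>m + 1\<close>.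
  Number the vertices as \<open>u\<^sub>i\<close> (\<open>i < n\<close>) and \<open>v\<^sub>j\<close> (\<open>j < m\<close>), give the edge \<open>u\<^sub>iv\<^sub>j\<close> the color \<open>i + j\<close>
  and the vertex \<open>v\<^sub>j\<close> the color \<open>j + n\<close>. Among the further colors, \<open>u\<^sub>i\<close> sees the cyclic arc of
  length \<open>m\<close> starting at \<open>i\<close>, and \<open>v\<^sub>j\<close> the arc of length \<open>n + 1\<close> starting at \<open>j\<close>. Proper arcs with
  different starts or different lengths are different, so all color sets within \<open>G\<^sub>1\<close>, within
  \<open>G\<^sub>2\<close> and across the join are distinct. The total \<open>D + m + 1 = \<Delta>(G\<^sub>1) + m + 3\<close> is at most
  \<open>\<Delta>(G) + 3\<close> unless \<open>G\<^sub>1\<close> is empty, and then the join has no edges.\<close>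

subsection \<open>Vizing's theorem\<close>

definition proper_edge_coloring :: "'a set set \<Rightarrow> ('a set \<Rightarrow> 'c) \<Rightarrow> bool" where
  "proper_edge_coloring E c \<longleftrightarrow>
     (\<forall>e\<in>E. \<forall>e'\<in>E. e \<noteq> e' \<longrightarrow> e \<inter> e' \<noteq> {} \<longrightarrow> c e \<noteq> c e')"

lemma proper_edge_coloringD:
  assumes "proper_edge_coloring E c" "e \<in> E" "e' \<in> E" "v \<in> e" "v \<in> e'" "c e = c e'"
  shows "e = e'"
  using assms unfolding proper_edge_coloring_def by blast

definition missing :: "'a set set \<Rightarrow> ('a set \<Rightarrow> 'c) \<Rightarrow> 'a \<Rightarrow> 'c \<Rightarrow> bool" where
  "missing E c v \<alpha> \<longleftrightarrow> (\<forall>e\<in>E. v \<in> e \<longrightarrow> c e \<noteq> \<alpha>)"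

text \<open>Pigeonhole: if all \<open>k\<close> colors occurred at \<open>v\<close>, there would be
  at least \<open>k\<close> edges at \<open>v\<close>.\<close>

lemma missing_color_exists:
  assumes "finite E" "card {e \<in> E. v \<in> e} < k"
  shows "\<exists>\<alpha><k. missing E c v \<alpha>"
proof (rule ccontr)
  assume "\<not> ?thesis"
  then have "{..<k} \<subseteq> c ` {e \<in> E. v \<in> e}"
    unfolding missing_def by blast
  then have "k \<le> card (c ` {e \<in> E. v \<in> e})"
    using assms(1) card_mono[of "c ` {e \<in> E. v \<in> e}" "{..<k}"] by simp
  also have "\<dots> \<le> card {e \<in> E. v \<in> e}"
    using assms(1) by (intro card_image_le) auto
  finally show False
    using assms(2) by simp
qed

text \<open>The vertex reached after \<open>i\<close> steps of the walk from \<open>x\<close> along edges colored alternately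
  \<open>\<beta>, \<alpha>, \<beta>, \<dots>\<close>; a relation, since the walk may stop.\<close>

primrec alt_walk :: "'a set set \<Rightarrow> ('a set \<Rightarrow> 'c) \<Rightarrow> 'c \<Rightarrow> 'c \<Rightarrow> 'a \<Rightarrow> nat \<Rightarrow> 'a \<Rightarrow> bool" where
  "alt_walk E c \<alpha> \<beta> x 0 v \<longleftrightarrow> v = x"
| "alt_walk E c \<alpha> \<beta> x (Suc i) v \<longleftrightarrow>
     (\<exists>u. alt_walk E c \<alpha> \<beta> x i u \<and> {u, v} \<in> E \<and> c {u, v} = (if even i then \<beta> else \<alpha>))"

text \<open>In a proper coloring a vertex has at most one edge of each color, so every step of the
  walk is forced.\<close>

lemma alt_walk_unique:
  assumes "proper_edge_coloring E c"
  shows "alt_walk E c \<alpha> \<beta> x i u \<Longrightarrow> alt_walk E c \<alpha> \<beta> x i v \<Longrightarrow> u = v"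
proof (induction i arbitrary: u v)
  case (Suc i)
  then obtain w where "{w, u} \<in> E" "{w, v} \<in> E" "c {w, u} = c {w, v}"
    by (metis alt_walk.simps(2))
  then have "{w, u} = {w, v}"
    using proper_edge_coloringD[OF assms, of _ _ w] by simp
  then show ?case
    by (auto simp: doubleton_eq_iff)
qed auto

lemma alt_walk_prefix:
  "alt_walk E c \<alpha> \<beta> x j v \<Longrightarrow> i \<le> j \<Longrightarrow> \<exists>u. alt_walk E c \<alpha> \<beta> x i u"
proof (induction j arbitrary: v)
  case (Suc j)
  show ?case
  proof (cases "i = Suc j")
    case False
    then show ?thesis
      using Suc by auto
  qed (use Suc.prems in blast)
qed auto

text \<open>A component of the subgraph formed by two colors is a path or a cycle, so besides an end \<open>x\<close>
  it contains at most one further end.\<close>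

lemma kempe_component:
  assumes proper: "proper_edge_coloring E c" and two: "\<forall>e\<in>E. card e = 2"
    and "missing E c x \<alpha>"
  obtains C where "x \<in> C"
    "\<And>e. e \<in> E \<Longrightarrow> c e \<in> {\<alpha>, \<beta>} \<Longrightarrow> e \<inter> C \<noteq> {} \<Longrightarrow> e \<subseteq> C"
    "\<And>v w. v \<in> C \<Longrightarrow> w \<in> C \<Longrightarrow> v \<noteq> x \<Longrightarrow> w \<noteq> x \<Longrightarrow>
       missing E c v \<beta> \<Longrightarrow> missing E c w \<beta> \<Longrightarrow> v = w"
proof
  \<comment> \<open>Since \<open>x\<close> misses \<alpha>, the walk can leave \<open>x\<close> only
    by a \<beta>-edge, so following this one direction reaches the whole component.\<close>
  define W where "W = alt_walk E c \<alpha> \<beta> x"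
  define C where "C = {v. \<exists>i. W i v}"
  have W_step: "W (Suc i) v" if "W i u" "{u, v} \<in> E" "c {u, v} = (if even i then \<beta> else \<alpha>)" for i u v
    using that unfolding W_def by auto
  show "x \<in> C"
    unfolding C_def W_def by (auto intro: exI[of _ 0])
  show "e \<subseteq> C" if e: "e \<in> E" "c e \<in> {\<alpha>, \<beta>}" "e \<inter> C \<noteq> {}" for e
  proof -
    obtain u i where u: "u \<in> e" "W i u"
      using e(3) by (auto simp: C_def)
    obtain v where v: "e = {u, v}"
      using two e(1) u(1) by (metis card_2_iff insert_commute insertE singletonD)
    have "v \<in> C"
    proof (cases "c e = (if even i then \<beta> else \<alpha>)")
      case True
      then show ?thesis
        using W_step u(2) e(1) v by (auto simp: C_def)
    next
      case False
      \<comment> \<open>An edge that does not continue the walk has the color by which the walk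
        arrived at \<open>u\<close>. At position 0 this would be an \<alpha>-edge at
        \<open>x\<close>; later it is the arriving edge itself, which leads back.\<close>
      then have incoming: "c e = (if even i then \<alpha> else \<beta>)"
        using e(2) by (auto split: if_splits)
      show ?thesis
      proof (cases i)
        case 0
        then show ?thesis
          using incoming u e(1) assms(3) by (auto simp: W_def missing_def)
      next
        case (Suc j)
        then obtain w where w: "W j w" "{w, u} \<in> E" "c {w, u} = (if even j then \<beta> else \<alpha>)"
          using u(2) unfolding W_def by auto
        then have "c {w, u} = c e"
          using incoming Suc by auto
        then have "e = {w, u}"
          using proper_edge_coloringD[OF proper e(1) w(2) u(1)] by simp
        then have "v = w"
          using v by (auto simp: doubleton_eq_iff)
        then show ?thesis
          using w(1) by (auto simp: C_def)
      qed
    qed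
    then show ?thesis
      using v u(2) by (auto simp: C_def)
  qed
  \<comment> \<open>The step after \<open>v\<close> would be colored \<beta>, which \<open>v\<close>
    misses, or \<alpha>, and then the step that led to \<open>v\<close> was colored \<beta>.\<close>
  have stuck: "\<not> W (Suc i) w" if walk: "W i v" and "v \<noteq> x" and free: "missing E c v \<beta>" for i v w
  proof
    assume "W (Suc i) w"
    then obtain u where u: "W i u" "{u, w} \<in> E" "c {u, w} = (if even i then \<beta> else \<alpha>)"
      unfolding W_def by auto
    have "u = v"
      using alt_walk_unique[OF proper] u(1) walk unfolding W_def by metis
    then have "odd i"
      using u free by (auto simp: missing_def split: if_splits)
    then obtain j where j: "i = Suc j" "even j"
      by (metis even_Suc odd_pos gr0_implies_Suc)
    then obtain t where "{t, v} \<in> E" "c {t, v} = \<beta>"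
      using walk j unfolding W_def by auto
    then show False
      using free by (auto simp: missing_def)
  qed
  show "v = w" if "v \<in> C" "w \<in> C" "v \<noteq> x" "w \<noteq> x" "missing E c v \<beta>" "missing E c w \<beta>" for v w
  proof -
    obtain i j where ij: "W i v" "W j w"
      using \<open>v \<in> C\<close> \<open>w \<in> C\<close> by (auto simp: C_def)
    have prefix: "\<exists>u. W i u" if "W j t" "i \<le> j" for i j t
      using alt_walk_prefix that unfolding W_def by metis
    \<comment> \<open>A walk that reaches position \<open>j\<close> would first have to leave
      position \<open>i\<close>, where it is stuck.\<close>
    have "\<not> i < j"
      using stuck[OF ij(1)] prefix[OF ij(2), of "Suc i"] that by auto
    moreover have "\<not> j < i"
      using stuck[OF ij(2)] prefix[OF ij(1), of "Suc j"] that by auto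
    ultimately have "i = j"
      by simp
    then show ?thesis
      using alt_walk_unique[OF proper] ij unfolding W_def by metis
  qed
qed

section \<open>Exchange of two colors on a Kempe component\<close>

definition kempe_swap :: "'c \<Rightarrow> 'c \<Rightarrow> 'a set \<Rightarrow> ('a set \<Rightarrow> 'c) \<Rightarrow> 'a set \<Rightarrow> 'c" where
  "kempe_swap \<alpha> \<beta> C c e = (if e \<inter> C \<noteq> {} then transpose \<alpha> \<beta> (c e) else c e)"

text \<open>An edge that meets \<open>C\<close> without lying in it has a color other than \<alpha>
  and \<beta>, which \<open>transpose\<close> fixes. Hence any one end decides, and at each vertex
  the exchange acts as a single permutation of the colors.\<close>

lemma kempe_swap_at:
  assumes closed: "\<And>e. e \<in> E \<Longrightarrow> c e \<in> {\<alpha>, \<beta>} \<Longrightarrow> e \<inter> C \<noteq> {} \<Longrightarrow> e \<subseteq> C"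
    and "e \<in> E" "v \<in> e"
  shows "kempe_swap \<alpha> \<beta> C c e = (if v \<in> C then transpose \<alpha> \<beta> (c e) else c e)"
proof (cases "v \<in> C \<or> e \<inter> C = {}")
  case True
  then show ?thesis
    using \<open>v \<in> e\<close> by (auto simp: kempe_swap_def)
next
  case False
  then have "c e \<notin> {\<alpha>, \<beta>}"
    using closed[of e] assms(2,3) by blast
  then show ?thesis
    using False by (simp add: kempe_swap_def)
qed

text \<open>At a common vertex of two edges the same injective map acts on both colors.\<close>

lemma proper_kempe_swap:
  assumes "\<And>e. e \<in> E \<Longrightarrow> c e \<in> {\<alpha>, \<beta>} \<Longrightarrow> e \<inter> C \<noteq> {} \<Longrightarrow> e \<subseteq> C"
    and "proper_edge_coloring E c"
  shows "proper_edge_coloring E (kempe_swap \<alpha> \<beta> C c)"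
  unfolding proper_edge_coloring_def
proof (intro ballI impI)
  fix e e'
  assume e: "e \<in> E" "e' \<in> E" "e \<noteq> e'" "e \<inter> e' \<noteq> {}"
  then obtain v where v: "v \<in> e" "v \<in> e'"
    by blast
  have "c e \<noteq> c e'"
    using e assms(2) by (auto simp: proper_edge_coloring_def)
  then show "kempe_swap \<alpha> \<beta> C c e \<noteq> kempe_swap \<alpha> \<beta> C c e'"
    using kempe_swap_at[of E c \<alpha> \<beta> C, OF assms(1) e(1) v(1)]
      kempe_swap_at[of E c \<alpha> \<beta> C, OF assms(1) e(2) v(2)]
    by (metis transpose_involutory)
qed

lemma missing_kempe_swap:
  assumes "\<And>e. e \<in> E \<Longrightarrow> c e \<in> {\<alpha>, \<beta>} \<Longrightarrow> e \<inter> C \<noteq> {} \<Longrightarrow> e \<subseteq> C"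
  shows "missing E (kempe_swap \<alpha> \<beta> C c) v \<gamma> \<longleftrightarrow>
    missing E c v (if v \<in> C then transpose \<alpha> \<beta> \<gamma> else \<gamma>)"
proof -
  have "kempe_swap \<alpha> \<beta> C c e = \<gamma> \<longleftrightarrow> c e = (if v \<in> C then transpose \<alpha> \<beta> \<gamma> else \<gamma>)"
    if "e \<in> E" "v \<in> e" for e
    using kempe_swap_at[of E c \<alpha> \<beta> C, OF assms that] by (metis transpose_involutory)
  then show ?thesis
    unfolding missing_def by blast
qed

section \<open>Vizing fans and their rotation\<close>

text \<open>The edge \<open>{x, hd ys}\<close> is the uncolored one.\<close>

definition fan :: "'a set set \<Rightarrow> ('a set \<Rightarrow> 'c) \<Rightarrow> 'a \<Rightarrow> 'a list \<Rightarrow> bool" where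
  "fan E c x ys \<longleftrightarrow> ys \<noteq> [] \<and> distinct ys \<and> (\<forall>y\<in>set ys. {x, y} \<in> E) \<and>
     (\<forall>i. Suc i < length ys \<longrightarrow>
        missing (E - {{x, hd ys}}) c (ys ! i) (c {x, ys ! Suc i}))"

text \<open>The inclusion in \<open>insert e\<^sub>0 F\<close> allows coloring
  \<open>e\<^sub>0\<close> and uncoloring another edge at once, as the rotation of a fan
  requires.\<close>

lemma proper_edge_coloring_upd:
  assumes "proper_edge_coloring F c" "E \<subseteq> insert e\<^sub>0 F"
    and "\<And>e. e \<in> E \<Longrightarrow> e \<noteq> e\<^sub>0 \<Longrightarrow> e \<inter> e\<^sub>0 \<noteq> {} \<Longrightarrow> c e \<noteq> \<gamma>"
  shows "proper_edge_coloring E (c(e\<^sub>0 := \<gamma>))"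
  unfolding proper_edge_coloring_def
proof (intro ballI impI)
  fix e e'
  assume e: "e \<in> E" "e' \<in> E" "e \<noteq> e'" "e \<inter> e' \<noteq> {}"
  consider "e = e\<^sub>0" | "e' = e\<^sub>0" | "e \<noteq> e\<^sub>0" "e' \<noteq> e\<^sub>0"
    by blast
  then show "(c(e\<^sub>0 := \<gamma>)) e \<noteq> (c(e\<^sub>0 := \<gamma>)) e'"
  proof cases
    case 1
    then show ?thesis
      using assms(3)[of e'] e by (simp add: Int_commute)
  next
    case 2
    then show ?thesis
      using assms(3)[of e] e by simp
  next
    case 3
    then have "e \<in> F" "e' \<in> F"
      using e assms(2) by blast+
    then show ?thesis
      using 3 e assms(1) by (simp add: proper_edge_coloring_def)
  qed
qed

text \<open>Each fan edge passes its color to its predecessor in the fan. The uncolored edge thereby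
  moves to the end of the fan, where \<beta> is missing at both ends and can be used. The induction
  moves it by one place at a time.\<close>

lemma fan_rotate:
  assumes "\<forall>e\<in>E. card e = 2"
    and "fan E c x ys" "proper_edge_coloring (E - {{x, hd ys}}) c" "\<forall>e\<in>E - {{x, hd ys}}. c e < k"
    and "missing (E - {{x, hd ys}}) c x \<beta>" "missing (E - {{x, hd ys}}) c (last ys) \<beta>" "\<beta> < k"
  shows "\<exists>c'. proper_edge_coloring E c' \<and> (\<forall>e\<in>E. c' e < (k::nat))"
  using assms(2-6)
proof (induction ys arbitrary: c)
  case Nil
  then show ?case by (simp add: fan_def)
next
  case (Cons y ys)
  let ?F = "E - {{x, y}}"
  note proper = Cons.prems(2)[simplified] and bound = Cons.prems(3)[simplified]
  have y: "{x, y} \<in> E"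
    using Cons.prems(1) by (simp add: fan_def)
  show ?case
  proof (cases ys)
    case Nil
    have at: "c e \<noteq> \<beta>" if "e \<in> ?F" "e \<inter> {x, y} \<noteq> {}" for e
      using Cons.prems(4,5) Nil that by (auto simp: missing_def)
    have "proper_edge_coloring E (c({x, y} := \<beta>))"
      using proper at by (intro proper_edge_coloring_upd[of ?F]) blast+
    moreover have "\<forall>e\<in>E. (c({x, y} := \<beta>)) e < k"
      using bound assms(7) by auto
    ultimately show ?thesis by blast
  next
    case (Cons z zs)
    \<comment> \<open>The edge \<open>{x, z}\<close> becomes the uncolored one, and its color goes
      to \<open>{x, y}\<close>; the fan condition says that \<open>y\<close> misses this
      color.\<close>
    let ?c = "c({x, y} := c {x, z})" and ?F' = "E - {{x, z}}"
    have z: "{x, z} \<in> E" "{x, z} \<noteq> {x, y}" "z \<noteq> y"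
      and miss: "missing ?F c y (c {x, z})"
      using Cons.prems(1) Cons by (auto simp: fan_def doubleton_eq_iff)
    have at: "c e \<noteq> c {x, z}" if "e \<in> E" "e \<noteq> {x, y}" "e \<noteq> {x, z}" "e \<inter> {x, y} \<noteq> {}" for e
    proof
      assume eq: "c e = c {x, z}"
      consider "x \<in> e" | "y \<in> e"
        using \<open>e \<inter> {x, y} \<noteq> {}\<close> by blast
      then show False
      proof cases
        case 1
        then show ?thesis
          using proper_edge_coloringD[OF proper, of e "{x, z}" x] that z eq by simp
      next
        case 2
        then show ?thesis
          using miss that eq by (auto simp: missing_def)
      qed
    qed
    have "proper_edge_coloring ?F' ?c"
      using proper at by (intro proper_edge_coloring_upd[of ?F]) blast+
    \<comment> \<open>The only recolored edge has the ends \<open>x\<close> and \<open>y\<close>, so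
      other vertices see no new color.\<close>
    moreover have unchanged: "missing ?F' ?c v \<gamma>" if "missing ?F c v \<gamma>" "v \<noteq> y" "v \<noteq> x" for v \<gamma>
      using that unfolding missing_def by auto
    \<comment> \<open>The new color of \<open>{x, y}\<close> was already present at
      \<open>x\<close>, on \<open>{x, z}\<close>.\<close>
    moreover have "missing ?F' ?c x \<beta>"
      using Cons.prems(4) z unfolding missing_def by auto
    moreover have neq: "v \<noteq> x" if "v \<in> set ys" for v
      using Cons.prems(1) that assms(1) by (fastforce simp: fan_def)
    moreover have "fan E ?c x ys"
    proof -
      have "missing ?F' ?c (ys ! i) (?c {x, ys ! Suc i})" if "Suc i < length ys" for i
      proof -
        have "ys ! i \<in> set ys" "ys ! Suc i \<in> set ys" "y \<notin> set ys"
          using that Cons.prems(1) by (auto simp: fan_def)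
        then have "ys ! i \<noteq> y" "ys ! i \<noteq> x" "{x, ys ! Suc i} \<noteq> {x, y}"
          using neq by (auto simp: doubleton_eq_iff)
        moreover have "missing ?F c (ys ! i) (c {x, ys ! Suc i})"
          using Cons.prems(1) that unfolding fan_def by fastforce
        ultimately show ?thesis
          using unchanged by simp
      qed
      then show ?thesis
        using Cons.prems(1) Cons by (auto simp: fan_def)
    qed
    moreover have "last ys \<in> set ys" "y \<notin> set ys"
      using Cons Cons.prems(1) by (auto simp: fan_def)
    moreover have "missing ?F c (last ys) \<beta>"
      using Cons.prems(5) Cons by simp
    moreover have "\<forall>e\<in>?F'. ?c e < k"
      using bound z by auto
    ultimately show ?thesis
      using Cons.IH[of ?c] Cons by (metis list.sel(1))
  qed
qed

text \<open>Fans consist of distinct vertices, so a longest one starting with \<open>y\<close>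
  exists. A vertex \<open>z\<close> violating the last property could be appended to it.\<close>

lemma fan_maximal:
  assumes "finite E" "\<forall>e\<in>E. card e = 2" "{x, y} \<in> E"
  obtains ys where "fan E c x ys" "hd ys = y"
    "\<And>z. z \<notin> set ys \<Longrightarrow> {x, z} \<in> E \<Longrightarrow> \<not> missing (E - {{x, y}}) c (last ys) (c {x, z})"
proof -
  let ?P = "\<lambda>ys. fan E c x ys \<and> hd ys = y"
  have fin: "finite (\<Union>E)"
    using assms(1,2) by (metis card.infinite finite_Union zero_neq_numeral)
  have "length ys < Suc (card (\<Union>E))" if "?P ys" for ys
  proof -
    have "set ys \<subseteq> \<Union>E" "distinct ys"
      using that by (auto simp: fan_def)
    then show ?thesis
      using card_mono[OF fin] by (metis distinct_card less_Suc_eq_le)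
  qed
  moreover have "?P [y]"
    using assms(3) by (simp add: fan_def)
  ultimately obtain ys where ys: "?P ys" and max: "\<And>zs. ?P zs \<Longrightarrow> length zs \<le> length ys"
    using ex_has_greatest_nat[of ?P "[y]" length "Suc (card (\<Union>E))"] by (metis order.strict_implies_order)
  have "\<not> missing (E - {{x, y}}) c (last ys) (c {x, z})" if z: "z \<notin> set ys" "{x, z} \<in> E" for z
  proof
    assume miss: "missing (E - {{x, y}}) c (last ys) (c {x, z})"
    have ne: "ys \<noteq> []"
      using ys by (simp add: fan_def)
    have "missing (E - {{x, y}}) c ((ys @ [z]) ! i) (c {x, (ys @ [z]) ! Suc i})"
      if "Suc i < length (ys @ [z])" for i
    proof (cases "Suc i < length ys")
      case True
      then show ?thesis
        using ys by (auto simp: fan_def nth_append)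
    next
      case False
      then have "i = length ys - 1" "Suc i = length ys"
        using that by auto
      then show ?thesis
        using miss ne by (auto simp: nth_append last_conv_nth)
    qed
    then have "?P (ys @ [z])"
      using ys z ne by (auto simp: fan_def)
    then show False
      using max[of "ys @ [z]"] by simp
  qed
  then show ?thesis
    using that ys by blast
qed

text \<open>Take a maximal fan at \<open>x\<close>, a color \<alpha> missing at \<open>x\<close> and
  a color \<beta> missing at the last fan vertex. If \<open>x\<close> has a \<beta>-edge, exchanging
  \<alpha> and \<beta> on the component of \<open>x\<close> frees \<beta> there, and the whole fan
  or an initial part of it can then be rotated.\<close>

lemma vizing_extend:
  assumes fin: "finite E" and two: "\<forall>e\<in>E. card e = 2"
    and deg: "\<And>v. card {e \<in> E. v \<in> e} < k"
    and e0: "{x, y} \<in> E"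
    and proper: "proper_edge_coloring (E - {{x, y}}) c" and bound: "\<forall>e\<in>E - {{x, y}}. c e < k"
  shows "\<exists>c'. proper_edge_coloring E c' \<and> (\<forall>e\<in>E. c' e < (k::nat))"
proof -
  let ?F = "E - {{x, y}}"
  obtain ys where fan: "fan E c x ys" and hd: "hd ys = y"
    and max: "\<And>z. z \<notin> set ys \<Longrightarrow> {x, z} \<in> E \<Longrightarrow> \<not> missing ?F c (last ys) (c {x, z})"
    using fan_maximal[OF fin two e0] by metis
  have ne: "ys \<noteq> []" and dist: "distinct ys"
    using fan by (auto simp: fan_def)
  have missing_ex: "\<exists>\<alpha><k. missing ?F c v \<alpha>" for v
  proof (rule missing_color_exists)
    have "card {e \<in> ?F. v \<in> e} \<le> card {e \<in> E. v \<in> e}"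
      using fin by (intro card_mono) auto
    then show "card {e \<in> ?F. v \<in> e} < k"
      using deg[of v] by simp
  qed (use fin in auto)
  obtain \<alpha> where \<alpha>: "\<alpha> < k" "missing ?F c x \<alpha>"
    using missing_ex by blast
  obtain \<beta> where \<beta>: "\<beta> < k" "missing ?F c (last ys) \<beta>"
    using missing_ex by blast
  show ?thesis
  proof (cases "missing ?F c x \<beta>")
    case True
    then show ?thesis
      using fan_rotate[OF two fan] proper bound \<beta> hd by simp
  next
    case False
    then obtain e where e: "e \<in> ?F" "x \<in> e" "c e = \<beta>"
      by (auto simp: missing_def)
    then obtain z where z: "e = {x, z}"
      using two by (metis DiffD1 card_2_iff insert_commute insertE singletonD)
    \<comment> \<open>By maximality the \<beta>-edge at \<open>x\<close> leads to a fan vertex. It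
      is not the first one, whose edge is uncolored, so it has a predecessor \<open>ys ! i\<close>,
      which misses \<beta>.\<close>
    have "z \<in> set ys"
      using max[of z] z e \<beta>(2) by auto
    then obtain l where l: "l < length ys" "ys ! l = z"
      by (auto simp: in_set_conv_nth)
    have "l \<noteq> 0"
      using l z e hd ne by (metis DiffD2 hd_conv_nth singletonI)
    then obtain i where i: "l = Suc i"
      by (cases l) auto
    have zi: "missing ?F c (ys ! i) \<beta>"
      using fan l z e i hd by (auto simp: fan_def)
    \<comment> \<open>Both \<open>ys ! i\<close> and \<open>last ys\<close> miss \<beta> and differ
      from \<open>x\<close>, so at most one of them can lie in the component of
      \<open>x\<close>.\<close>
    obtain C where C: "x \<in> C"
      and closed: "\<And>e. e \<in> ?F \<Longrightarrow> c e \<in> {\<alpha>, \<beta>} \<Longrightarrow> e \<inter> C \<noteq> {} \<Longrightarrow> e \<subseteq> C"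
      and ends: "\<And>v w. v \<in> C \<Longrightarrow> w \<in> C \<Longrightarrow> v \<noteq> x \<Longrightarrow> w \<noteq> x \<Longrightarrow>
        missing ?F c v \<beta> \<Longrightarrow> missing ?F c w \<beta> \<Longrightarrow> v = w"
      using kempe_component[OF proper _ \<alpha>(2), of \<beta>] two by (metis (no_types, lifting) DiffD1)
    define d where "d = kempe_swap \<alpha> \<beta> C c"
    have d_proper: "proper_edge_coloring ?F d"
      unfolding d_def using closed proper by (rule proper_kempe_swap)
    have d_missing: "missing ?F d v \<gamma> \<longleftrightarrow> missing ?F c v (if v \<in> C then transpose \<alpha> \<beta> \<gamma> else \<gamma>)" for v \<gamma>
      unfolding d_def using closed by (rule missing_kempe_swap)
    have d_bound: "\<forall>e\<in>?F. d e < k"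
      using bound \<alpha>(1) \<beta>(1) by (auto simp: d_def kempe_swap_def transpose_def)
    have d_x: "missing ?F d x \<beta>"
      using d_missing C \<alpha>(2) by simp
    have not_x: "v \<noteq> x" if "v \<in> set ys" for v
      using fan that two by (fastforce simp: fan_def)
    have fan_edge: "{x, ys ! Suc j} \<in> ?F" if "Suc j < length ys" for j
    proof -
      have "ys ! Suc j \<noteq> y"
        using hd that dist ne by (metis hd_conv_nth length_greater_0_conv nat.distinct(1) nth_eq_iff_index_eq)
      then show ?thesis
        using fan that by (auto simp: fan_def doubleton_eq_iff)
    qed
    have d_z: "d {x, z} = \<alpha>"
      using C e z by (auto simp: d_def kempe_swap_def)
    \<comment> \<open>At \<open>x\<close> no edge has color \<alpha> and only \<open>{x, z}\<close>
      has color \<beta>, so the exchange recolors no other fan edge.\<close>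
    have d_fan_edge: "d {x, ys ! Suc j} = c {x, ys ! Suc j} \<and> c {x, ys ! Suc j} \<notin> {\<alpha>, \<beta>}"
      if j: "Suc j < length ys" "j \<noteq> i" for j
    proof -
      have "c {x, ys ! Suc j} \<noteq> \<alpha>"
        using fan_edge[OF j(1)] \<alpha>(2) by (auto simp: missing_def)
      moreover have "ys ! Suc j \<noteq> z"
        using j l i dist by (metis nth_eq_iff_index_eq Suc_inject)
      then have "{x, ys ! Suc j} \<noteq> e"
        using z by (auto simp: doubleton_eq_iff)
      then have "c {x, ys ! Suc j} \<noteq> \<beta>"
        using proper_edge_coloringD[OF proper fan_edge[OF j(1)] e(1) _ e(2)] e(3) by auto
      ultimately show ?thesis
        by (auto simp: d_def kempe_swap_def)
    qed
    have d_fan: "missing ?F d (ys ! j) (d {x, ys ! Suc j})" if j: "Suc j < length ys" "j \<noteq> i" for j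
    proof -
      have "missing ?F c (ys ! j) (c {x, ys ! Suc j})"
        using fan j hd by (auto simp: fan_def)
      then show ?thesis
        using d_missing d_fan_edge[OF j] by auto
    qed
    show ?thesis
    proof (cases "missing ?F d (ys ! i) \<beta>")
      case True
      \<comment> \<open>The part of the fan up to \<open>ys ! i\<close> avoids the recolored edge
        \<open>{x, z}\<close>, so it is still a fan and can be rotated with \<beta>.\<close>
      let ?zs = "take (Suc i) ys"
      have zs: "hd ?zs = y" "last ?zs = ys ! i"
        using hd ne l i by (auto simp: last_conv_nth hd_conv_nth min_def)
      have "fan E d x ?zs"
        using fan d_fan hd ne l i unfolding fan_def by (auto dest: in_set_takeD simp: zs(1))
      then show ?thesis
        using fan_rotate[OF two] d_proper d_bound d_x True \<beta>(1) zs by metis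
    next
      case False
      then have i_C: "ys ! i \<in> C"
        using d_missing zi by (auto split: if_splits)
      have "last ys \<noteq> ys ! i"
        using l i dist ne by (metis One_nat_def Suc_diff_Suc Suc_lessD diff_Suc_1 diff_less last_conv_nth
            length_greater_0_conv less_irrefl nth_eq_iff_index_eq zero_less_one not_less_eq)
      then have "last ys \<notin> C"
        using ends[OF i_C] zi \<beta>(2) not_x l i ne by (metis Suc_lessD last_in_set nth_mem)
      then have last: "missing ?F d (last ys) \<beta>"
        using d_missing \<beta>(2) by simp
      \<comment> \<open>Here \<open>ys ! i\<close> lies in \<open>C\<close>, so it now misses
        \<alpha> instead of \<beta>, and \<alpha> is just the new color of \<open>{x, z}\<close>.
        The whole fan survives.\<close>
      have "missing ?F d (ys ! i) (d {x, ys ! Suc i})"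
        using d_missing i_C zi d_z l i by auto
      then have "missing ?F d (ys ! j) (d {x, ys ! Suc j})" if "Suc j < length ys" for j
        using d_fan that by metis
      then have "fan E d x ys"
        using fan hd by (simp add: fan_def)
      then show ?thesis
        using fan_rotate[OF two] d_proper d_bound d_x last \<beta>(1) hd by metis
    qed
  qed
qed

text \<open>The edges are inserted one at a time. Taking \<open>k\<close> to be the maximum degree
  plus 1 gives the usual bound.\<close>

theorem vizing:
  assumes "finite E" "\<forall>e\<in>E. card e = 2" "\<And>v. card {e \<in> E. v \<in> e} < k"
  shows "\<exists>c. proper_edge_coloring E c \<and> (\<forall>e\<in>E. c e < (k::nat))"
  using assms
proof (induction E rule: finite_induct)
  case empty
  then show ?case by (simp add: proper_edge_coloring_def)
next
  case (insert e E)
  have "card {f \<in> E. v \<in> f} < k" for v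
  proof -
    have "card {f \<in> E. v \<in> f} \<le> card {f \<in> insert e E. v \<in> f}"
      using insert.hyps by (intro card_mono) auto
    then show ?thesis
      using insert.prems(2)[of v] by simp
  qed
  then obtain c where c: "proper_edge_coloring E c" "\<forall>e\<in>E. c e < k"
    using insert by auto
  obtain x y where "e = {x, y}"
    using insert.prems(1) by (auto simp: card_2_iff)
  moreover have "insert e E - {e} = E"
    using insert.hyps by simp
  ultimately show ?case
    using vizing_extend[of "insert e E" k x y c] insert c by simp
qed

subsection \<open>Cyclic arcs\<close>

definition arc :: "nat \<Rightarrow> nat \<Rightarrow> nat \<Rightarrow> nat set" where
  "arc N s l = (\<lambda>i. (s + i) mod N) ` {..<l}"

text \<open>Turns a residue of a sum of two residues into a case distinction for linear
  arithmetic.\<close>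

lemma mod_less_double: "a < 2 * N \<Longrightarrow> a mod N = (if a < N then a else a - N)" for a N :: nat
  by (simp add: le_mod_geq)

lemma mod_add_left_inj:
  assumes "i < N" "j < N" "(s + i) mod N = (s + j) mod N"
  shows "i = (j::nat)"
proof -
  have "(s mod N + i) mod N = (s mod N + j) mod N" "s mod N < N"
    using assms by (simp_all add: mod_add_left_eq)
  then show ?thesis
    using assms(1,2) by (auto simp: mod_less_double split: if_splits)
qed

lemma card_arc:
  assumes "l \<le> N"
  shows "card (arc N s l) = l"
proof -
  have "inj_on (\<lambda>i. (s + i) mod N) {..<l}"
  proof (rule inj_onI)
    fix i j assume "i \<in> {..<l}" "j \<in> {..<l}" and eq: "(s + i) mod N = (s + j) mod N"
    then have "i < N" "j < N"
      using assms by auto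
    then show "i = j"
      using eq by (rule mod_add_left_inj)
  qed
  then show ?thesis
    by (simp add: arc_def card_image)
qed

text \<open>The residue of \<open>x + N - s\<close> counts the cyclic steps from \<open>s\<close> to
  \<open>x\<close>; adding \<open>N\<close> keeps the subtraction from truncating.\<close>

lemma mem_arc:
  assumes "x < N" "s < N" "l \<le> N"
  shows "x \<in> arc N s l \<longleftrightarrow> (x + N - s) mod N < l"
proof
  assume "x \<in> arc N s l"
  then obtain i where i: "i < l" "x = (s + i) mod N"
    by (auto simp: arc_def)
  then have "(x + N - s) mod N = i"
    using assms by (simp add: mod_less_double)
  then show "(x + N - s) mod N < l"
    using i by simp
next
  assume l: "(x + N - s) mod N < l"
  have "x = (s + (x + N - s) mod N) mod N"
    using assms by (simp add: mod_less_double)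
  then show "x \<in> arc N s l"
    using l unfolding arc_def by blast
qed

text \<open>The start of an arc is its only element whose cyclic predecessor lies outside.\<close>

lemma arc_start_unique:
  assumes "arc N s l = arc N t l" "s < N" "t < N" "0 < l" "l < N"
  shows "s = t"
proof (rule ccontr)
  assume "s \<noteq> t"
  define r where "r = (s + N - 1) mod N"
  have "r < N" and r: "r = (if s = 0 then N - 1 else s - 1)"
    using assms(2) by (auto simp: r_def mod_less_double)
  have "s \<in> arc N t l"
    using assms by (subst assms(1)[symmetric], subst mem_arc) auto
  then have "(s + N - t) mod N < l"
    using assms mem_arc by simp
  \<comment> \<open>The distance from \<open>t\<close> to \<open>s\<close> is positive because
    \<open>s\<close> and \<open>t\<close> differ, so the predecessor \<open>r\<close> of
    \<open>s\<close> is one step closer to \<open>t\<close>.\<close>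
  then have "(r + N - t) mod N < l"
    using assms \<open>s \<noteq> t\<close> by (auto simp: r mod_less_double split: if_splits)
  then have "r \<in> arc N s l"
    unfolding assms(1) using mem_arc[OF \<open>r < N\<close> assms(3)] assms(5) by simp
  then have "(r + N - s) mod N < l"
    using mem_arc[OF \<open>r < N\<close> assms(2)] assms(5) by simp
  \<comment> \<open>The distance from \<open>s\<close> to \<open>r\<close> is \<open>N - 1\<close>,
    which is at least \<open>l\<close>.\<close>
  then show False
    using assms by (auto simp: r mod_less_double split: if_splits)
qed

subsection \<open>Degrees and edges of the join\<close>

lemma finite_edges: "finite_simple_graph G \<Longrightarrow> finite (edges G)"
  unfolding finite_simple_graph_def by (meson PowI finite_Pow_iff finite_subset subsetI)

lemma vertex_degree_le_max_degree:
  assumes "finite_simple_graph G"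
  shows "vertex_degree G v \<le> max_degree G"
proof (cases "v \<in> verts G")
  case True
  then show ?thesis
    using assms by (simp add: max_degree_def finite_simple_graph_def)
next
  case False
  then have "{e \<in> edges G. v \<in> e} = {}"
    using assms by (auto simp: finite_simple_graph_def)
  then show ?thesis
    unfolding vertex_degree_def by (simp only: card.empty le0)
qed

lemma max_degree_attained:
  assumes "finite_simple_graph G" "verts G \<noteq> {}"
  obtains v where "v \<in> verts G" "vertex_degree G v = max_degree G"
proof -
  have "max_degree G \<in> insert 0 (vertex_degree G ` verts G)"
    unfolding max_degree_def using assms(1) by (intro Max_in) (auto simp: finite_simple_graph_def)
  moreover obtain w where "w \<in> verts G"
    using assms(2) by blast
  \<comment> \<open>If the maximum is the inserted 0, every degree is 0 and \<open>w\<close> attains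
    it.\<close>
  ultimately show ?thesis
    using that vertex_degree_le_max_degree[OF assms(1), of w] by auto
qed

lemma edges_graph_join_Inl [simp]:
  fixes G :: "'a ugraph" and H :: "'b ugraph"
  shows "{Inl u, Inl w} \<in> edges (graph_join G H) \<longleftrightarrow> {u, w} \<in> edges G"
proof -
  have "({Inl u, Inl w} :: ('a + 'b) set) = Inl ` e \<longleftrightarrow> e = {u, w}" for e :: "'a set"
    using inj_image_eq_iff[OF inj_Inl, of "{u, w}" e] by auto
  moreover have "{Inl u, Inl w} \<noteq> Inr ` e" for e :: "'b set"
    by blast
  ultimately show ?thesis
    by (simp add: graph_join_def image_iff doubleton_eq_iff)
qed

lemma edges_graph_join_Inr [simp]:
  fixes G :: "'a ugraph" and H :: "'b ugraph"
  shows "{Inr u, Inr w} \<in> edges (graph_join G H) \<longleftrightarrow> {u, w} \<in> edges H"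
proof -
  have "({Inr u, Inr w} :: ('a + 'b) set) = Inr ` e \<longleftrightarrow> e = {u, w}" for e :: "'b set"
    using inj_image_eq_iff[OF inj_Inr, of "{u, w}" e] by auto
  moreover have "{Inr u, Inr w} \<noteq> Inl ` e" for e :: "'a set"
    by blast
  ultimately show ?thesis
    by (simp add: graph_join_def image_iff doubleton_eq_iff)
qed

lemma edges_graph_join_Inl_Inr [simp]:
  fixes G :: "'a ugraph" and H :: "'b ugraph"
  shows "{Inl u, Inr v} \<in> edges (graph_join G H) \<longleftrightarrow> u \<in> verts G \<and> v \<in> verts H"
proof -
  have "{Inl u, Inr v} \<noteq> Inl ` e" for e :: "'a set"
    by blast
  moreover have "{Inl u, Inr v} \<noteq> Inr ` e" for e :: "'b set"
    by blast
  ultimately show ?thesis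
    by (simp add: graph_join_def image_iff doubleton_eq_iff)
qed

lemma edges_graph_join_Inr_Inl [simp]:
  "{Inr v, Inl u} \<in> edges (graph_join G H) \<longleftrightarrow> u \<in> verts G \<and> v \<in> verts H"
  by (subst insert_commute) simp

lemma edges_graph_join_cases:
  assumes "e \<in> edges (graph_join G H)"
  obtains (left) e' where "e = Inl ` e'" "e' \<in> edges G"
  | (right) e' where "e = Inr ` e'" "e' \<in> edges H"
  | (cross) u v where "e = {Inl u, Inr v}" "u \<in> verts G" "v \<in> verts H"
  using assms unfolding graph_join_def by auto

lemma vertex_degree_join_Inl:
  assumes "finite_simple_graph G" "finite_simple_graph H" "u \<in> verts G"
  shows "vertex_degree G u + card (verts H) \<le> vertex_degree (graph_join G H) (Inl u)"
proof -
  let ?A = "(\<lambda>e. Inl ` e :: ('a + 'b) set) ` {e \<in> edges G. u \<in> e}"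
  let ?B = "(\<lambda>v. {Inl u, Inr v}) ` verts H"
  have fin: "finite ?A" "finite ?B"
    using assms finite_edges[OF assms(1)] by (simp_all add: finite_simple_graph_def)
  have "card ?A = vertex_degree G u"
    unfolding vertex_degree_def by (intro card_image inj_onI) (simp add: inj_image_eq_iff)
  moreover have "card ?B = card (verts H)"
    by (intro card_image inj_onI) (auto simp: doubleton_eq_iff)
  moreover have "?A \<inter> ?B = {}"
    by blast
  ultimately have "vertex_degree G u + card (verts H) = card (?A \<union> ?B)"
    using fin by (simp add: card_Un_disjoint)
  also have "\<dots> \<le> vertex_degree (graph_join G H) (Inl u)"
    unfolding vertex_degree_def using assms finite_edges[OF finite_simple_graph_join[OF assms(1,2)]]
    by (intro card_mono) (auto simp: graph_join_def)
  finally show ?thesis .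
qed

text \<open>A vertex of maximum degree in \<open>G\<close> gains an edge to every vertex of
  \<open>H\<close>. This growth of the maximum degree pays for the colors added for the
  join.\<close>

lemma max_degree_join:
  assumes "finite_simple_graph G" "finite_simple_graph H" "verts G \<noteq> {}"
  shows "max_degree G + card (verts H) \<le> max_degree (graph_join G H)"
proof -
  obtain u where u: "u \<in> verts G" "vertex_degree G u = max_degree G"
    using max_degree_attained[OF assms(1,3)] .
  have "max_degree G + card (verts H) \<le> vertex_degree (graph_join G H) (Inl u)"
    using vertex_degree_join_Inl[OF assms(1,2) u(1)] u(2) by simp
  also have "\<dots> \<le> max_degree (graph_join G H)"
    by (intro vertex_degree_le_max_degree finite_simple_graph_join assms)
  finally show ?thesis .
qed

subsection \<open>Coloring the join\<close>

text \<open>Sorts the colors by origin, so that those below and those from \<open>D\<close> on can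
  be separated later.\<close>

lemma color_set_join_Inl:
  assumes "u \<in> verts G"
  shows "color_set (graph_join G H) f (Inl u) = {f (Vertex (Inl u))}
    \<union> (\<lambda>w. f (Edge {Inl u, Inl w})) ` {w. {u, w} \<in> edges G}
    \<union> (\<lambda>v. f (Edge {Inl u, Inr v})) ` verts H"
proof -
  have "{w. {Inl u, w} \<in> edges (graph_join G H)} = Inl ` {w. {u, w} \<in> edges G} \<union> Inr ` verts H"
    (is "?L = ?R")
  proof (rule set_eqI)
    fix w show "w \<in> ?L \<longleftrightarrow> w \<in> ?R"
      using assms by (cases w) auto
  qed
  then show ?thesis
    by (simp add: color_set_def setcompr_eq_image image_Un image_image)
qed

lemma color_set_join_Inr:
  assumes "v \<in> verts H"
  shows "color_set (graph_join G H) f (Inr v) = {f (Vertex (Inr v))}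
    \<union> (\<lambda>w. f (Edge {Inr v, Inr w})) ` {w. {v, w} \<in> edges H}
    \<union> (\<lambda>u. f (Edge {Inl u, Inr v})) ` verts G"
proof -
  have "{w. {Inr v, w} \<in> edges (graph_join G H)} = Inr ` {w. {v, w} \<in> edges H} \<union> Inl ` verts G"
    (is "?L = ?R")
  proof (rule set_eqI)
    fix w show "w \<in> ?L \<longleftrightarrow> w \<in> ?R"
      using assms by (cases w) auto
  qed
  moreover have "(\<lambda>u. f (Edge {Inr v, Inl u})) ` verts G = (\<lambda>u. f (Edge {Inl u, Inr v})) ` verts G"
    by (simp add: insert_commute)
  ultimately show ?thesis
    by (simp add: color_set_def setcompr_eq_image image_Un image_image Un_assoc)
qed

text \<open>The condition on two edges is put contrapositively, with their common end explicit,
  which suits a case analysis on the kinds of edges.\<close>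

lemma proper_total_coloringI:
  assumes "\<And>u v. {u, v} \<in> edges G \<Longrightarrow> f (Vertex u) \<noteq> f (Vertex v)"
    and "\<And>v e. e \<in> edges G \<Longrightarrow> v \<in> e \<Longrightarrow> f (Vertex v) \<noteq> f (Edge e)"
    and "\<And>v e e'. e \<in> edges G \<Longrightarrow> e' \<in> edges G \<Longrightarrow> v \<in> e \<Longrightarrow> v \<in> e' \<Longrightarrow>
      f (Edge e) = f (Edge e') \<Longrightarrow> e = e'"
  shows "proper_total_coloring G f"
  unfolding proper_total_coloring_def
proof (intro ballI impI)
  fix x y
  assume x: "x \<in> elements G" and y: "y \<in> elements G" and adj: "adjacent_or_incident G x y"
  have edge: "e \<in> edges G" if "Edge e \<in> elements G" for e
    using that by (auto simp: elements_def)
  show "f x \<noteq> f y"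
  proof (cases x; cases y)
    fix u v assume "x = Vertex u" "y = Vertex v"
    then show ?thesis using adj assms(1) by simp
  next
    fix u e assume "x = Vertex u" "y = Edge e"
    then show ?thesis using adj y edge assms(2) by simp
  next
    fix u e assume "x = Edge e" "y = Vertex u"
    then show ?thesis using adj x edge assms(2)[of e u] by simp
  next
    fix e e' assume xy: "x = Edge e" "y = Edge e'"
    then obtain v where "v \<in> e" "v \<in> e'" "e \<noteq> e'"
      using adj by auto
    then show ?thesis using xy x y edge assms(3)[of e e' v] by auto
  qed
qed

lemma proper_total_coloringD:
  assumes "proper_total_coloring G f" "finite_simple_graph G"
  shows "{u, v} \<in> edges G \<Longrightarrow> f (Vertex u) \<noteq> f (Vertex v)"
    and "e \<in> edges G \<Longrightarrow> v \<in> e \<Longrightarrow> f (Vertex v) \<noteq> f (Edge e)"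
    and "e \<in> edges G \<Longrightarrow> e' \<in> edges G \<Longrightarrow> v \<in> e \<Longrightarrow> v \<in> e' \<Longrightarrow> f (Edge e) = f (Edge e') \<Longrightarrow> e = e'"
proof -
  have sep: "f x \<noteq> f y" if "x \<in> elements G" "y \<in> elements G" "adjacent_or_incident G x y" for x y
    using assms(1) that unfolding proper_total_coloring_def by blast
  have sub: "e \<subseteq> verts G" if "e \<in> edges G" for e
    using assms(2) that by (simp add: finite_simple_graph_def)
  show "f (Vertex u) \<noteq> f (Vertex v)" if "{u, v} \<in> edges G"
    using sub[OF that] that by (intro sep) (auto simp: elements_def)
  show "f (Vertex v) \<noteq> f (Edge e)" if "e \<in> edges G" "v \<in> e"
    using sub[OF that(1)] that by (intro sep) (auto simp: elements_def)
  show "e = e'" if "e \<in> edges G" "e' \<in> edges G" "v \<in> e" "v \<in> e'" "f (Edge e) = f (Edge e')"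
    using sep[of "Edge e" "Edge e'"] that by (auto simp: elements_def)
qed

text \<open>The shift by \<open>D\<close> separates the further colors from those that the two
  factors share. Preimages recover an edge of a factor, and \<open>the_elem\<close> extracts the
  only end of a crossing edge on either side.\<close>

fun join_coloring :: "nat \<Rightarrow> nat \<Rightarrow> nat \<Rightarrow> ('a element \<Rightarrow> nat) \<Rightarrow> ('b set \<Rightarrow> nat) \<Rightarrow>
    ('a \<Rightarrow> nat) \<Rightarrow> ('b \<Rightarrow> nat) \<Rightarrow> ('a + 'b) element \<Rightarrow> nat" where
  "join_coloring D N n f g p q (Vertex (Inl u)) = f (Vertex u)"
| "join_coloring D N n f g p q (Vertex (Inr v)) = D + (q v + n) mod N"
| "join_coloring D N n f g p q (Edge e) =
    (if e \<subseteq> range Inl then f (Edge (Inl -` e))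
     else if e \<subseteq> range Inr then g (Inr -` e)
     else D + (q (the_elem (Inr -` e)) + p (the_elem (Inl -` e))) mod N)"

lemma join_coloring_left: "join_coloring D N n f g p q (Edge (Inl ` e)) = f (Edge e)"
  by (auto simp: inj_vimage_image_eq)

text \<open>The empty set would be caught by the first branch of the definition.\<close>

lemma join_coloring_right:
  "e \<noteq> {} \<Longrightarrow> join_coloring D N n f g p q (Edge (Inr ` e)) = g e"
  by (auto simp: inj_vimage_image_eq)

lemma join_coloring_cross:
  "join_coloring D N n f g p q (Edge {Inl u, Inr v}) = D + (q v + p u) mod N"
proof -
  have "Inl -` {Inl u, Inr v} = {u}" "Inr -` {Inl u, Inr v} = {v}"
    by auto
  moreover have "\<not> {Inl u, Inr v} \<subseteq> range Inl" "\<not> {Inl u, Inr v} \<subseteq> range Inr"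
    by auto
  ultimately show ?thesis by simp
qed

text \<open>The inequality \<open>n + 1 < m\<close> keeps the offsets from 0 to \<open>n\<close>
  distinct modulo \<open>m + 1\<close> and makes \<open>m\<close> and \<open>n + 1\<close> two
  different lengths of proper arcs.\<close>

lemma avd_join_coloring:
  fixes G1 :: "'a ugraph" and G2 :: "'b ugraph"
  assumes G: "finite_simple_graph G1" "finite_simple_graph G2"
    and f: "proper_total_coloring G1 f" "f ` elements G1 \<subseteq> {..<D}"
    and g: "proper_edge_coloring (edges G2) g" "\<forall>e\<in>edges G2. g e < D"
    and p: "bij_betw p (verts G1) {..<n}" and q: "bij_betw q (verts G2) {..<m}"
    and "n + 1 < m"
  defines "F \<equiv> join_coloring D (m + 1) n f g p q"
  shows "F ` elements (graph_join G1 G2) \<subseteq> {..<D + m + 1}"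
    and "avd_total_coloring (graph_join G1 G2) F"
proof -
  let ?J = "graph_join G1 G2"
  have F_left: "F (Edge (Inl ` e)) = f (Edge e)" for e
    unfolding F_def by (rule join_coloring_left)
  have F_right: "F (Edge (Inr ` e)) = g e" if "e \<in> edges G2" for e
    unfolding F_def using G(2) that
    by (intro join_coloring_right) (auto simp: finite_simple_graph_def)
  have F_cross: "F (Edge {Inl u, Inr v}) = D + (q v + p u) mod (m + 1)" for u v
    unfolding F_def by (rule join_coloring_cross)
  have F_Inl: "F (Vertex (Inl u)) = f (Vertex u)" for u
    by (simp add: F_def)
  have F_Inr: "F (Vertex (Inr v)) = D + (q v + n) mod (m + 1)" for v
    by (simp add: F_def)
  have f_edge: "f (Edge e) < D" if "e \<in> edges G1" for e
    using f(2) that by (auto simp: elements_def)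
  have f_vertex: "f (Vertex u) < D" if "u \<in> verts G1" for u
    using f(2) that by (auto simp: elements_def)
  have g_edge: "g e < D" if "e \<in> edges G2" for e
    using g(2) that by blast
  have p_less: "p u < n" if "u \<in> verts G1" for u
    using p that by (auto simp: bij_betw_def)
  have q_less: "q v < m" if "v \<in> verts G2" for v
    using q that by (auto simp: bij_betw_def)
  have p_inj: "u = u'" if "p u = p u'" "u \<in> verts G1" "u' \<in> verts G1" for u u'
    using p that by (auto simp: bij_betw_def inj_on_def)
  have q_inj: "v = v'" if "q v = q v'" "v \<in> verts G2" "v' \<in> verts G2" for v v'
    using q that by (auto simp: bij_betw_def inj_on_def)
  have sub1: "e \<subseteq> verts G1" if "e \<in> edges G1" for e
    using G(1) that by (simp add: finite_simple_graph_def)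
  have sub2: "e \<subseteq> verts G2" if "e \<in> edges G2" for e
    using G(2) that by (simp add: finite_simple_graph_def)
  have loop: "{v} \<notin> edges G2" for v
    using G(2) by (auto simp: finite_simple_graph_def)

  \<comment> \<open>Range of the coloring\<close>
  show "F ` elements ?J \<subseteq> {..<D + m + 1}"
  proof
    fix c assume "c \<in> F ` elements ?J"
    moreover have "verts ?J = Inl ` verts G1 \<union> Inr ` verts G2"
      by (simp add: graph_join_def)
    ultimately consider u where "u \<in> verts G1" "c = F (Vertex (Inl u))"
      | v where "v \<in> verts G2" "c = F (Vertex (Inr v))"
      | e where "e \<in> edges ?J" "c = F (Edge e)"
      by (auto simp: elements_def)
    then show "c \<in> {..<D + m + 1}"
    proof cases
      case 1
      then show ?thesis using f_vertex[of u] by (simp add: F_Inl)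
    next
      case 2
      then show ?thesis by (simp add: F_Inr less_Suc_eq_le)
    next
      case 3
      from 3(1) show ?thesis
      proof (cases rule: edges_graph_join_cases)
        case (left e')
        then show ?thesis using f_edge[of e'] 3 by (simp add: F_left)
      next
        case (right e')
        then show ?thesis using g_edge[of e'] 3 by (simp add: F_right)
      next
        case (cross u v)
        then show ?thesis using 3 by (simp add: F_cross less_Suc_eq_le)
      qed
    qed
  qed

  \<comment> \<open>Properness of the coloring\<close>
  have proper: "proper_total_coloring ?J F"
  proof (rule proper_total_coloringI)
    fix x y assume xy: "{x, y} \<in> edges ?J"
    show "F (Vertex x) \<noteq> F (Vertex y)"
    proof (cases x; cases y)
      fix u v assume *: "x = Inl u" "y = Inl v"
      then show ?thesis using xy proper_total_coloringD(1)[OF f(1) G(1)] by (simp add: F_Inl)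
    next
      fix u v assume *: "x = Inl u" "y = Inr v"
      then show ?thesis using xy f_vertex[of u] by (simp add: F_Inl F_Inr)
    next
      fix u v assume *: "x = Inr v" "y = Inl u"
      then show ?thesis using xy f_vertex[of u] by (simp add: F_Inl F_Inr)
    next
      fix v v' assume *: "x = Inr v" "y = Inr v'"
      then have e: "{v, v'} \<in> edges G2"
        using xy by simp
      then have "v \<noteq> v'" "v \<in> verts G2" "v' \<in> verts G2"
        using loop[of v] sub2[OF e] by auto
      then have "(n + q v) mod (m + 1) \<noteq> (n + q v') mod (m + 1)"
        using mod_add_left_inj[of "q v" "m + 1" "q v'" n] q_inj q_less by fastforce
      then show ?thesis
        using * by (simp add: F_Inr add.commute)
    qed
  next
    fix x e assume e: "e \<in> edges ?J" and x: "x \<in> e"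
    from e show "F (Vertex x) \<noteq> F (Edge e)"
    proof (cases rule: edges_graph_join_cases)
      case (left e')
      then obtain u where "x = Inl u" "u \<in> e'"
        using x by blast
      then show ?thesis
        using left proper_total_coloringD(2)[OF f(1) G(1)] by (simp add: F_left F_Inl)
    next
      case (right e')
      then obtain v where "x = Inr v" "v \<in> e'"
        using x by blast
      then show ?thesis
        using right g_edge[of e'] by (simp add: F_right F_Inr)
    next
      case (cross u v)
      then consider "x = Inl u" | "x = Inr v"
        using x by blast
      then show ?thesis
      proof cases
        case 1
        then show ?thesis
          using cross f_vertex[of u] by (simp add: F_Inl F_cross)
      next
        case 2
        \<comment> \<open>The vertex uses the offset \<open>n\<close>, just beyond the offsets
          \<open>p u < n\<close> of its crossing edges.\<close>
        have "(q v + n) mod (m + 1) \<noteq> (q v + p u) mod (m + 1)"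
          using mod_add_left_inj[of n "m + 1" "p u" "q v"] p_less[of u] cross \<open>n + 1 < m\<close> by auto
        then show ?thesis
          using 2 cross by (simp add: F_Inr F_cross)
      qed
    qed
  next
    fix x e e'
    assume e: "e \<in> edges ?J" "e' \<in> edges ?J" "x \<in> e" "x \<in> e'" "F (Edge e) = F (Edge e')"
    \<comment> \<open>Edges inside a factor have colors below \<open>D\<close>, crossing edges
      colors from \<open>D\<close> on.\<close>
    have mixed: False
      if "F (Edge e) = F (Edge e')" "e \<in> edges ?J" "e = Inl ` d \<and> d \<in> edges G1 \<or> e = Inr ` d' \<and> d' \<in> edges G2"
        "e' = {Inl u, Inr v}" for e e' d d' u v
      using that f_edge[of d] g_edge[of d'] by (auto simp: F_left F_right F_cross)
    from e(1) show "e = e'"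
    proof (cases rule: edges_graph_join_cases)
      case (left d)
      note l = left
      from e(2) show ?thesis
      proof (cases rule: edges_graph_join_cases)
        case (left d')
        obtain u where "x = Inl u" "u \<in> d" "u \<in> d'"
          using l left e by blast
        then have "d = d'"
          using proper_total_coloringD(3)[OF f(1) G(1), of d d' u] l left e(5) by (simp add: F_left)
        then show ?thesis
          using l left by simp
      next
        \<comment> \<open>Edges of different factors have no common end, which is why the factors
          may share colors.\<close>
        case right
        then show ?thesis
          using l e by blast
      next
        case cross
        then show ?thesis
          using l mixed e by metis
      qed
    next
      case (right d)
      note r = right
      from e(2) show ?thesis
      proof (cases rule: edges_graph_join_cases)
        case left
        then show ?thesis
          using r e by blast
      next
        case (right d')
        obtain v where "x = Inr v" "v \<in> d" "v \<in> d'"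
          using r right e by blast
        then have "d = d'"
          using proper_edge_coloringD[OF g(1), of d d' v] r right e(5) by (simp add: F_right)
        then show ?thesis
          using r right by simp
      next
        case cross
        then show ?thesis
          using r mixed e by metis
      qed
    next
      case (cross u v)
      note c = cross
      from e(2) show ?thesis
      proof (cases rule: edges_graph_join_cases)
        case left
        then show ?thesis
          using c mixed e by metis
      next
        case right
        then show ?thesis
          using c mixed e by metis
      next
        case (cross u' v')
        have eq: "(q v + p u) mod (m + 1) = (q v' + p u') mod (m + 1)"
          using e(5) c cross by (simp add: F_cross)
        \<comment> \<open>The common end fixes one summand of the color; the other is below
          \<open>m + 1\<close> and hence determined by the residue.\<close>
        consider "x = Inl u" "u = u'" | "x = Inr v" "v = v'"
          using e c cross by blast
        then show ?thesis
        proof cases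
          case 1
          then have "(p u + q v) mod (m + 1) = (p u + q v') mod (m + 1)"
            using eq by (simp add: add.commute)
          then have "q v = q v'"
            by (rule mod_add_left_inj[rotated 2]) (use q_less c cross in \<open>auto intro: less_SucI\<close>)
          then have "v = v'"
            using q_inj c(3) cross(3) by blast
          then show ?thesis
            using c cross 1 by simp
        next
          case 2
          then have "(q v + p u) mod (m + 1) = (q v + p u') mod (m + 1)"
            using eq by simp
          moreover have "p u < m + 1" "p u' < m + 1"
            using p_less[of u] p_less[of u'] c cross \<open>n + 1 < m\<close> by auto
          ultimately have "p u = p u'"
            using mod_add_left_inj by blast
          then have "u = u'"
            using p_inj c(2) cross(2) by blast
          then show ?thesis
            using c cross 2 by simp
        qed
      qed
    qed
  qed

  \<comment> \<open>Color sets restricted to the further colors\<close>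
  have high_Inl: "color_set ?J F (Inl u) \<inter> {D..} = (+) D ` arc (m + 1) (p u) m"
    if u: "u \<in> verts G1" for u
  proof -
    have "F (Edge {Inl u, Inl w}) < D" if "{u, w} \<in> edges G1" for w
      using F_left[of "{u, w}"] f_edge[OF that] by simp
    then have "color_set ?J F (Inl u) \<inter> {D..} = (\<lambda>v. D + (p u + q v) mod (m + 1)) ` verts G2"
      unfolding color_set_join_Inl[OF u]
      using f_vertex[OF u] by (fastforce simp: F_Inl F_cross add.commute)
    also have "\<dots> = (+) D ` (\<lambda>i. (p u + i) mod (m + 1)) ` q ` verts G2"
      by (simp add: image_image)
    finally show ?thesis
      using q by (simp add: arc_def bij_betw_def)
  qed
  have high_Inr: "color_set ?J F (Inr v) \<inter> {D..} = (+) D ` arc (m + 1) (q v) (n + 1)"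
    if v: "v \<in> verts G2" for v
  proof -
    have "F (Edge {Inr v, Inr w}) < D" if "{v, w} \<in> edges G2" for w
      using F_right[OF that] g_edge[OF that] by simp
    then have "color_set ?J F (Inr v) \<inter> {D..} =
        insert (D + (q v + n) mod (m + 1)) ((\<lambda>u. D + (q v + p u) mod (m + 1)) ` verts G1)"
      unfolding color_set_join_Inr[OF v] by (fastforce simp: F_Inr F_cross)
    also have "\<dots> = (+) D ` (\<lambda>i. (q v + i) mod (m + 1)) ` insert n (p ` verts G1)"
      by (simp add: image_image)
    \<comment> \<open>The crossing edges contribute the offsets below \<open>n\<close>, and the
      color of the vertex itself extends the arc by one.\<close>
    also have "insert n (p ` verts G1) = {..<n + 1}"
      using p by (auto simp: bij_betw_def)
    finally show ?thesis
      by (simp only: arc_def)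
  qed

  have inj_D: "inj ((+) D)"
    by simp
  have cross_neq: "color_set ?J F (Inl u) \<noteq> color_set ?J F (Inr v)" if "u \<in> verts G1" "v \<in> verts G2" for u v
  proof
    assume "color_set ?J F (Inl u) = color_set ?J F (Inr v)"
    then have "arc (m + 1) (p u) m = arc (m + 1) (q v) (n + 1)"
      using high_Inl[OF that(1)] high_Inr[OF that(2)] by (simp add: inj_image_eq_iff[OF inj_D])
    then have "m = n + 1"
      using card_arc[of m "m + 1" "p u"] card_arc[of "n + 1" "m + 1" "q v"] \<open>n + 1 < m\<close> by simp
    then show False
      using \<open>n + 1 < m\<close> by simp
  qed
  have "color_set ?J F x \<noteq> color_set ?J F y" if xy: "{x, y} \<in> edges ?J" for x y
  proof (cases x; cases y)
    fix u u' assume *: "x = Inl u" "y = Inl u'"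
    then have e: "{u, u'} \<in> edges G1"
      using xy by simp
    then have u: "u \<noteq> u'" "u \<in> verts G1" "u' \<in> verts G1"
      using sub1[OF e] G(1) by (auto simp: finite_simple_graph_def)
    have "arc (m + 1) (p u) m \<noteq> arc (m + 1) (p u') m"
      using arc_start_unique[of "m + 1" "p u" m "p u'"] p_inj u p_less[of u] p_less[of u'] \<open>n + 1 < m\<close>
      by auto
    then show ?thesis
      using high_Inl u * by (metis inj_image_eq_iff[OF inj_D])
  next
    fix v v' assume *: "x = Inr v" "y = Inr v'"
    then have e: "{v, v'} \<in> edges G2"
      using xy by simp
    then have v: "v \<noteq> v'" "v \<in> verts G2" "v' \<in> verts G2"
      using sub2[OF e] loop[of v] by auto
    have "arc (m + 1) (q v) (n + 1) \<noteq> arc (m + 1) (q v') (n + 1)"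
      using arc_start_unique[of "m + 1" "q v" "n + 1" "q v'"] q_inj v q_less[of v] q_less[of v'] \<open>n + 1 < m\<close>
      by auto
    then show ?thesis
      using high_Inr v * by (metis inj_image_eq_iff[OF inj_D])
  next
    fix u v assume "x = Inl u" "y = Inr v"
    then show ?thesis
      using cross_neq xy by simp
  next
    fix u v assume "x = Inr v" "y = Inl u"
    then show ?thesis
      using cross_neq[of u v] xy by auto
  qed
  then show "avd_total_coloring ?J F"
    using proper by (simp add: avd_total_coloring_def)
qed

lemma avd_total_chromatic_number_le:
  fixes f :: "'a element \<Rightarrow> nat"
  assumes "f ` elements G \<subseteq> {..<k}" "avd_total_coloring G f"
  shows "avd_total_chromatic_number G \<le> k"
  unfolding avd_total_chromatic_number_def using assms by (intro Least_le) blast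

theorem theorem4p5:
  fixes G1 :: "'a ugraph" and G2 :: "'b ugraph" and n m :: nat
  assumes "finite_simple_graph G1"
    and "finite_simple_graph G2"
    and "card (verts G1) = n"
    and "card (verts G2) = m"
    and "m > n + 1"
    and "max_degree G1 \<ge> max_degree G2"
    and "total_chromatic_number G1 \<le> max_degree G1 + 2"
  shows "avd_total_chromatic_number (graph_join G1 G2) \<le> max_degree (graph_join G1 G2) + 3"
proof (cases "verts G1 = {}")
  case True
  have "edges G1 = {}"
    using assms(1) True by (fastforce simp: finite_simple_graph_def)
  \<comment> \<open>The graph without vertices has maximum degree 0, and the degree assumption
    passes this on to \<open>G2\<close>.\<close>
  moreover have "edges G2 = {}"
  proof (rule ccontr)
    assume "edges G2 \<noteq> {}"
    then obtain e where e: "e \<in> edges G2"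
      by blast
    then obtain v where "v \<in> e"
      using assms(2) by (fastforce simp: finite_simple_graph_def)
    then have "vertex_degree G2 v > 0"
      using e finite_edges[OF assms(2)] by (auto simp: vertex_degree_def card_gt_0_iff)
    moreover have "max_degree G1 = 0"
      using True by (simp add: max_degree_def)
    ultimately show False
      using vertex_degree_le_max_degree[OF assms(2), of v] assms(6) by simp
  qed
  ultimately have "edges (graph_join G1 G2) = {}"
    using True by (auto simp: graph_join_def)
  then have "avd_total_coloring (graph_join G1 G2) (\<lambda>_. 0::nat)"
    by (auto simp: avd_total_coloring_def intro!: proper_total_coloringI)
  then have "avd_total_chromatic_number (graph_join G1 G2) \<le> 1"
    by (intro avd_total_chromatic_number_le[of "\<lambda>_. 0"]) auto
  then show ?thesis by simp
next
  case False
  let ?D = "max_degree G1 + 2"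
  obtain f :: "'a element \<Rightarrow> nat" where f: "f ` elements G1 \<subseteq> {..<total_chromatic_number G1}"
    "proper_total_coloring G1 f"
    using total_chromatic_number_attained[OF assms(1)] by blast
  then have f_less: "f ` elements G1 \<subseteq> {..<?D}"
    using assms(7) by fastforce
  \<comment> \<open>The degree assumption enters here: the colors available for \<open>G1\<close>
    also exceed every degree in \<open>G2\<close>, so Vizing's theorem applies.\<close>
  have "card {e \<in> edges G2. v \<in> e} < ?D" for v
    using vertex_degree_le_max_degree[OF assms(2), of v] assms(6) by (simp add: vertex_degree_def)
  moreover have "\<forall>e\<in>edges G2. card e = 2"
    using assms(2) by (simp add: finite_simple_graph_def)
  ultimately obtain g where g: "proper_edge_coloring (edges G2) g" "\<forall>e\<in>edges G2. g e < ?D"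
    using vizing[OF finite_edges[OF assms(2)], of ?D] by blast
  obtain p where p: "bij_betw p (verts G1) {..<n}"
    using ex_bij_betw_finite_nat[of "verts G1"] assms(1,3)
    by (auto simp: finite_simple_graph_def atLeast0LessThan)
  obtain q where q: "bij_betw q (verts G2) {..<m}"
    using ex_bij_betw_finite_nat[of "verts G2"] assms(2,4)
    by (auto simp: finite_simple_graph_def atLeast0LessThan)
  have "avd_total_chromatic_number (graph_join G1 G2) \<le> ?D + m + 1"
    using avd_join_coloring[OF assms(1,2) f(2) f_less g p q assms(5)]
    by (rule avd_total_chromatic_number_le)
  then show ?thesis
    using max_degree_join[OF assms(1,2) False] assms(4) by simp
qed

end
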